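(* Let $\eta\in(0,1)$ and let $z=p\odot b\in\mathbb{R}^d$ (entrywise product), where $p\sim\mathcal N(0,I_d)$ and $b=(b_1,\dots,b_d)$ has i.i.d. entries $b_i\sim\mathrm{Bernoulli}(\eta)$, independent of $p$. Let $x^*=e_1$ be the first canonical basis vector, and consider $f_{\mathrm{dic}}(x)=\mathbb{E}_z[|x\cdot z|]$. Let $\xi>1$ be an absolute constant and, for $\alpha>0$, define $$S_\alpha=\Big\{x\in\mathbb{S}^{d-1}:\ x_1\ge\xi\max_{i\ge2}|x_i|,\ \cos\theta(x,x^* )\ge\alpha\Big\}.$$ Then $f_{\mathrm{dic}}$ is $\mu$-RGA on $(S_\alpha,x^* )$ with $$\mu=\frac{\alpha^3\,\eta(1-\eta)(1-1/\xi^2)}{\sqrt{2\pi}} .$$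
   Context: $\mathbb{S}^{d-1}$ is the unit sphere of $\mathbb{R}^d$; $\theta(x,y)=\arccos(x\cdot y)$ for unit vectors. For a locally Lipschitz $f$, $\partial^Cf(x)$ is the Clarke subdifferential (convex hull of limits of gradients at differentiability points $y_k\to x$) and $\partial^{C,R}f(x)=\{(I-xx^\top)\xi':\xi'\in\partial^Cf(x)\}$. $f$ is $\mu$-RGA at $(x,x^* )$ if every $g(x)\in\partial^{C,R}f(x)$ satisfies: $g(x)\neq0$ whenever $x\ne x^*$, and $g(x)\cdot x^*\le-\mu\,\sin(\theta(x,x^* ))\,\|g(x)\|_2$. $f$ is $\mu$-RGA on $(\mathcal X,x^* )$ if this holds at $(x,x^* )$ for every $x\in\mathcal X$. *)

theory Defs
  imports "HOL-Probability.Probability"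
begin

definition locally_lipschitz :: "('a::metric_space \<Rightarrow> 'b::metric_space) \<Rightarrow> bool" where
  "locally_lipschitz f \<longleftrightarrow> (\<forall>x. \<exists>r>0. \<exists>L. L-lipschitz_on (ball x r) f)"

definition clarke_subdifferential :: "('a::euclidean_space \<Rightarrow> real) \<Rightarrow> 'a \<Rightarrow> 'a set" where
  "clarke_subdifferential f x =
     convex hull {v. \<exists>y g. y \<longlonglongrightarrow> x \<and> (\<forall>k::nat. GDERIV f (y k) :> g k) \<and> g \<longlonglongrightarrow> v}"

text \<open>\<open>v - (x \<bullet> v) x\<close> is \<open>(I - x x\<^sup>T) v\<close>, the projection onto the tangent space of the sphere at \<open>x\<close>.\<close>

definition riemannian_clarke_subdifferential ::
    "('a::euclidean_space \<Rightarrow> real) \<Rightarrow> 'a \<Rightarrow> 'a set" where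
  "riemannian_clarke_subdifferential f x =
     (\<lambda>v. v - (x \<bullet> v) *\<^sub>R x) ` clarke_subdifferential f x"

text \<open>Meaningful only for unit vectors.\<close>

definition sphere_angle :: "'a::real_inner \<Rightarrow> 'a \<Rightarrow> real" where
  "sphere_angle x y = arccos (x \<bullet> y)"

definition RGA_at :: "real \<Rightarrow> ('a::euclidean_space \<Rightarrow> real) \<Rightarrow> 'a \<Rightarrow> 'a \<Rightarrow> bool" where
  "RGA_at \<mu> f x xs \<longleftrightarrow>
     (\<forall>g \<in> riemannian_clarke_subdifferential f x.
        (x \<noteq> xs \<longrightarrow> g \<noteq> 0) \<and>
        g \<bullet> xs \<le> - \<mu> * sin (sphere_angle x xs) * norm g)"

text \<open>The Clarke subdifferential is only considered for locally Lipschitz functions, so this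
  standing requirement is part of the notion.  It guarantees that the subdifferentials
  are nonempty, i.e. that the condition at each point is not vacuous.\<close>

definition RGA_on :: "real \<Rightarrow> ('a::euclidean_space \<Rightarrow> real) \<Rightarrow> 'a set \<Rightarrow> 'a \<Rightarrow> bool" where
  "RGA_on \<mu> f X xs \<longleftrightarrow> locally_lipschitz f \<and> (\<forall>x\<in>X. RGA_at \<mu> f x xs)"

text \<open>The standard normal law \<open>N(0, I)\<close>: independent standard normal entries.\<close>

definition std_normal_vector :: "'s measure \<Rightarrow> ('s \<Rightarrow> real ^ 'n) \<Rightarrow> bool" where
  "std_normal_vector M p \<longleftrightarrow>
     prob_space.indep_vars M (\<lambda>_. borel) (\<lambda>i \<omega>. p \<omega> $ i) UNIV \<and>
     (\<forall>i. distributed M lborel (\<lambda>\<omega>. p \<omega> $ i) std_normal_density)"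

text \<open>The library's Bernoulli distribution lives on \<^typ>\<open>bool\<close>; here it is transported to
  \<open>{0, 1}\<close> in the reals.\<close>

definition bernoulli_vector :: "real \<Rightarrow> 's measure \<Rightarrow> ('s \<Rightarrow> real ^ 'n) \<Rightarrow> bool" where
  "bernoulli_vector \<eta> M b \<longleftrightarrow>
     prob_space.indep_vars M (\<lambda>_. borel) (\<lambda>i \<omega>. b \<omega> $ i) UNIV \<and>
     (\<forall>i. distr M borel (\<lambda>\<omega>. b \<omega> $ i) = distr (measure_pmf (bernoulli_pmf \<eta>)) borel of_bool)"

definition f_dic :: "'s measure \<Rightarrow> ('s \<Rightarrow> real ^ 'n) \<Rightarrow> real ^ 'n \<Rightarrow> real" where
  "f_dic M z x = (\<integral>\<omega>. \<bar>x \<bullet> z \<omega>\<bar> \<partial>M)"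

text \<open>The index type carries no order, so the coordinate \<open>i1\<close> playing the role of the first
  one is a parameter.  The bound by the maximum over the other coordinates is written
  pointwise; it is void in dimension one.\<close>

definition S_dic :: "real \<Rightarrow> 'n::finite \<Rightarrow> real \<Rightarrow> (real ^ 'n) set" where
  "S_dic \<xi> i1 \<alpha> =
     {x \<in> sphere 0 1. (\<forall>i. i \<noteq> i1 \<longrightarrow> x $ i1 \<ge> \<xi> * \<bar>x $ i\<bar>) \<and>
        cos (sphere_angle x (axis i1 1)) \<ge> \<alpha>}"

end

theory Submission
  imports Defs
begin

text \<open>
  Conditioning on the set \<open>B\<close> of indices with \<open>b\<^sub>i = 1\<close>, the variable \<open>x \<bullet> z\<close> is centred
  normal with standard deviation \<open>N\<^sub>B(x) = (\<Sum>i\<in>B. x\<^sub>i\<^sup>2)\<^sup>1\<^sup>/\<^sup>2\<close>. Hence the objective is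
  \<open>f = c \<cdot> (\<Sum>B. w(B) N\<^sub>B)\<close> with \<open>c = sqrt (2 / \<pi>)\<close> and \<open>w(B)\<close> the probability of \<open>B\<close>
  (\<open>f_dic_eq_mean_masked_norm\<close>).

  This \<open>f\<close> is not differentiable where a coordinate vanishes, but the claim needs only three things
  about a Clarke subgradient \<open>v\<close> at \<open>x\<close>: \<open>\<parallel>v\<parallel> \<le> 1\<close>, as \<open>f\<close> is 1-Lipschitz; \<open>x \<bullet> v = f(x)\<close>,
  Euler's identity, as \<open>f\<close> is absolutely homogeneous; and \<open>e\<^sub>1 \<bullet> v = \<partial>\<^sub>1f(x)\<close>, as the partial
  derivative \<open>\<partial>\<^sub>1f\<close> exists and is continuous wherever \<open>x\<^sub>1 \<noteq> 0\<close>. All three pass from gradients to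
  limits and convex combinations (\<open>clarke_subdifferential_homogeneous\<close>). So every element
  \<open>g = v - (x \<bullet> v) x\<close> of the Riemannian subdifferential has \<open>\<parallel>g\<parallel> \<le> 1\<close> and the same inner
  product \<open>g \<bullet> e\<^sub>1 = \<partial>\<^sub>1f(x) - x\<^sub>1f(x)\<close>, and it is enough to bound the latter by
  \<open>- \<mu> sin \<theta>\<close>, which is negative, so that \<open>g \<noteq> 0\<close>, unless \<open>x = e\<^sub>1\<close>.

  Since \<open>x\<close> is a unit vector, that quantity equals
  \<open>c x\<^sub>1 (\<Sum>i. x\<^sub>i\<^sup>2 (\<Sum>B. w(B) ([1 \<in> B] - [i \<in> B]) / N\<^sub>B))\<close>. Only the sets containing exactly
  one of \<open>1\<close> and \<open>i\<close> contribute. Exchanging \<open>1\<close> and \<open>i\<close> pairs them up as \<open>C \<union> {1}\<close> and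
  \<open>C \<union> {i}\<close>, which gives \<open>\<eta> (1 - \<eta>)\<close> times an average of \<open>1 / N\<^bsub>C \<union> {1}\<^esub> - 1 / N\<^bsub>C \<union> {i}\<^esub>\<close>.
  Because \<open>N\<^bsub>C \<union> {1}\<^esub> \<le> 1\<close>, \<open>N\<^bsub>C \<union> {i}\<^esub> \<le> sin \<theta>\<close> and \<open>x\<^sub>i\<^sup>2 \<le> x\<^sub>1\<^sup>2 / \<xi>\<^sup>2\<close>, each difference
  with \<open>x\<^sub>i \<noteq> 0\<close> is at most \<open>- (1 - 1 / \<xi>\<^sup>2) x\<^sub>1\<^sup>2 / (2 sin \<theta>)\<close>. Summing over \<open>i \<noteq> 1\<close> with weights \<open>x\<^sub>i\<^sup>2\<close>,
  whose total is \<open>sin\<^sup>2 \<theta>\<close>, gives the bound with \<open>x\<^sub>1\<^sup>3\<close> in place of \<open>\<alpha>\<^sup>3\<close>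
  (\<open>mean_masked_norm_radial_excess_le\<close>), and \<open>x\<^sub>1 \<ge> \<alpha>\<close>.
\<close>

section \<open>Weights of random index sets\<close>

text \<open>The probability that a random subset of \<open>A\<close>, containing each element independently with
  probability \<open>\<eta>\<close>, equals \<open>B\<close>. Only \<open>B \<inter> A\<close> matters, so sums range over \<open>B \<subseteq> A\<close>.\<close>

definition mask_weight :: "real \<Rightarrow> 'n set \<Rightarrow> 'n set \<Rightarrow> real" where
  "mask_weight \<eta> A B = (\<Prod>j\<in>A. if j \<in> B then \<eta> else 1 - \<eta>)"

text \<open>The expected Euclidean norm of \<open>x\<close> after each coordinate is kept independently with
  probability \<open>\<eta>\<close> and set to \<open>0\<close> otherwise.\<close>

definition mean_masked_norm :: "real \<Rightarrow> real ^ 'n \<Rightarrow> real" where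
  "mean_masked_norm \<eta> x = (\<Sum>B\<in>UNIV. mask_weight \<eta> UNIV B * L2_set (($) x) B)"

lemma mask_weight_nonneg: "0 \<le> \<eta> \<Longrightarrow> \<eta> \<le> 1 \<Longrightarrow> 0 \<le> mask_weight \<eta> A B"
  unfolding mask_weight_def by (intro prod_nonneg) auto

lemma sum_mask_weight:
  assumes "finite A"
  shows "(\<Sum>B\<in>Pow A. mask_weight \<eta> A B) = 1"
proof -
  have "mask_weight \<eta> A B = (\<Prod>j\<in>B. \<eta>) * (\<Prod>j\<in>A - B. 1 - \<eta>)" if "B \<in> Pow A" for B
  proof -
    have "mask_weight \<eta> A B = (\<Prod>j\<in>A - B. if j \<in> B then \<eta> else 1 - \<eta>) * (\<Prod>j\<in>B. if j \<in> B then \<eta> else 1 - \<eta>)"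
      unfolding mask_weight_def using that assms by (intro prod.subset_diff) auto
    then show ?thesis by (simp add: mult.commute)
  qed
  then have "(\<Sum>B\<in>Pow A. mask_weight \<eta> A B) = (\<Prod>j\<in>A. \<eta> + (1 - \<eta>))"
    using prod_add[OF assms, of "\<lambda>_. \<eta>" "\<lambda>_. 1 - \<eta>"] by simp
  then show ?thesis by simp
qed

lemma mask_weight_insert:
  fixes k i :: "'n::finite"
  assumes "k \<noteq> i" "C \<subseteq> - {k, i}"
  shows "mask_weight \<eta> UNIV (insert k C) = \<eta> * (1 - \<eta>) * mask_weight \<eta> (- {k, i}) C"
proof -
  have U: "UNIV = insert k (insert i (- {k, i}))" by auto
  have "mask_weight \<eta> UNIV (insert k C) = \<eta> * ((1 - \<eta>) * (\<Prod>j\<in>- {k, i}. if j \<in> insert k C then \<eta> else 1 - \<eta>))"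
    unfolding mask_weight_def using assms by (subst U) auto
  also have "(\<Prod>j\<in>- {k, i}. if j \<in> insert k C then \<eta> else 1 - \<eta>) = mask_weight \<eta> (- {k, i}) C"
    unfolding mask_weight_def by (intro prod.cong) auto
  finally show ?thesis by (simp add: mult.assoc)
qed

lemma sum_mask_weight_one_of_two:
  fixes k i :: "'n::finite"
  assumes "k \<noteq> i"
  shows "(\<Sum>B | k \<in> B \<and> i \<notin> B. mask_weight \<eta> UNIV B * \<phi> B)
    = \<eta> * (1 - \<eta>) * (\<Sum>C\<in>Pow (- {k, i}). mask_weight \<eta> (- {k, i}) C * \<phi> (insert k C))"
proof -
  have "(\<Sum>B | k \<in> B \<and> i \<notin> B. mask_weight \<eta> UNIV B * \<phi> B)
    = (\<Sum>C\<in>Pow (- {k, i}). \<eta> * (1 - \<eta>) * (mask_weight \<eta> (- {k, i}) C * \<phi> (insert k C)))"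
  proof (rule sum.reindex_bij_witness[where i = "insert k" and j = "\<lambda>B. B - {k}"])
    fix B assume "B \<in> {B. k \<in> B \<and> i \<notin> B}"
    moreover from this have "B - {k} \<subseteq> - {k, i}" by auto
    ultimately show "\<eta> * (1 - \<eta>) * (mask_weight \<eta> (- {k, i}) (B - {k}) * \<phi> (insert k (B - {k})))
        = mask_weight \<eta> UNIV B * \<phi> B"
      using mask_weight_insert[OF assms, of "B - {k}" \<eta>] by (simp add: insert_absorb)
  qed (use assms in auto)
  then show ?thesis by (simp add: sum_distrib_left)
qed

text \<open>Exchanging \<open>k\<close> and \<open>i\<close> preserves the weight, so the sets containing both or neither
  cancel, and the others are compared in pairs.\<close>

lemma sum_mask_weight_swap:
  fixes k i :: "'n::finite"
  assumes "k \<noteq> i"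
  shows "(\<Sum>B\<in>UNIV. mask_weight \<eta> UNIV B * ((of_bool (k \<in> B) - of_bool (i \<in> B)) * \<phi> B))
    = \<eta> * (1 - \<eta>) * (\<Sum>C\<in>Pow (- {k, i}). mask_weight \<eta> (- {k, i}) C * (\<phi> (insert k C) - \<phi> (insert i C)))"
proof -
  let ?w = "mask_weight \<eta> UNIV :: 'n set \<Rightarrow> real"
  have "(\<Sum>B\<in>UNIV. ?w B * ((of_bool (k \<in> B) - of_bool (i \<in> B)) * \<phi> B))
    = (\<Sum>B\<in>UNIV. (if k \<in> B \<and> i \<notin> B then ?w B * \<phi> B else 0)
                 - (if i \<in> B \<and> k \<notin> B then ?w B * \<phi> B else 0))"
    by (intro sum.cong) auto
  also have "\<dots> = (\<Sum>B | k \<in> B \<and> i \<notin> B. ?w B * \<phi> B) - (\<Sum>B | i \<in> B \<and> k \<notin> B. ?w B * \<phi> B)"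
    by (simp add: sum_subtractf sum.If_cases)
  also have "\<dots> = \<eta> * (1 - \<eta>) * (\<Sum>C\<in>Pow (- {k, i}). mask_weight \<eta> (- {k, i}) C * \<phi> (insert k C))
     - \<eta> * (1 - \<eta>) * (\<Sum>C\<in>Pow (- {i, k}). mask_weight \<eta> (- {i, k}) C * \<phi> (insert i C))"
    using assms by (simp add: sum_mask_weight_one_of_two)
  also have "{i, k} = {k, i}" by auto
  finally show ?thesis by (simp add: right_diff_distrib sum_subtractf)
qed

section \<open>The radial component of the gradient\<close>

lemma inverse_sqrt_diff_ge:
  fixes a b s :: real
  assumes "0 < a" "a \<le> b" "b \<le> 1" "sqrt a \<le> s"
  shows "1 / sqrt a - 1 / sqrt b \<ge> (b - a) / (2 * s)"
proof -
  define u v where "u = sqrt a" and "v = sqrt b"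
  have uv: "0 < u" "u \<le> v" "v \<le> 1" "u \<le> s" "a = u\<^sup>2" "b = v\<^sup>2"
    using assms by (auto simp: u_def v_def)
  \<comment> \<open>\<open>v\<close> and \<open>u + v\<close> are bounded by \<open>1\<close> and \<open>2\<close>; only the factor \<open>u\<close> is bounded by \<open>s\<close>.\<close>
  have "(b - a) / (2 * s) \<le> (b - a) / (u * v * (u + v))"
  proof (intro divide_left_mono)
    have "v * (u + v) \<le> 1 * 2" using uv by (intro mult_mono) auto
    then have "u * (v * (u + v)) \<le> u * 2" using uv by (intro mult_left_mono) auto
    also have "\<dots> \<le> 2 * s" using uv by simp
    finally show "u * v * (u + v) \<le> 2 * s" by (simp add: mult.assoc)
  qed (use uv assms in auto)
  also have "(b - a) / (u * v * (u + v)) = (v - u) * (u + v) / (u * v * (u + v))"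
    by (simp add: uv power2_eq_square algebra_simps)
  also have "(v - u) * (u + v) / (u * v * (u + v)) = (v - u) / (u * v)"
    using uv by (intro nonzero_mult_divide_mult_cancel_right) auto
  also have "\<dots> = 1 / u - 1 / v"
    using uv by (simp add: diff_divide_distrib)
  finally show ?thesis by (simp add: u_def v_def)
qed

lemma L2_set_power2: "(L2_set f A)\<^sup>2 = (\<Sum>i\<in>A. (f i)\<^sup>2)"
  unfolding L2_set_def by (simp add: sum_nonneg)

text \<open>If \<open>x\<^sub>k \<noteq> 0\<close>, then on the left is the \<open>k\<close>-th partial derivative of the mean masked norm
  minus \<open>x\<^sub>k\<close> times its value, that is, the \<open>k\<close>-th component of its gradient (where there is one)
  projected to the tangent space at \<open>x\<close>. The norm of a masked vector may vanish; the convention \<open>a / 0 = 0\<close> then gives the right value on both sides.\<close>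

lemma mean_masked_norm_radial_excess:
  fixes x :: "real ^ 'n"
  assumes "norm x = 1"
  shows "(\<Sum>B\<in>UNIV. mask_weight \<eta> UNIV B * (of_bool (k \<in> B) * x $ k / L2_set (($) x) B))
      - x $ k * mean_masked_norm \<eta> x
    = x $ k * (\<Sum>i\<in>UNIV. (x $ i)\<^sup>2 *
       (\<Sum>B\<in>UNIV. mask_weight \<eta> UNIV B * ((of_bool (k \<in> B) - of_bool (i \<in> B)) * (1 / L2_set (($) x) B))))"
proof -
  let ?w = "mask_weight \<eta> UNIV :: 'n set \<Rightarrow> real" and ?N = "L2_set (($) x)"
  have unit: "(\<Sum>i\<in>UNIV. (x $ i)\<^sup>2) = 1"
    using assms by (simp add: norm_vec_def L2_set_def)
  have *: "of_bool (k \<in> B) / ?N B - ?N B = (\<Sum>i\<in>UNIV. (x $ i)\<^sup>2 * ((of_bool (k \<in> B) - of_bool (i \<in> B)) * (1 / ?N B)))"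
    for B
  proof -
    have "?N B = (\<Sum>i\<in>B. (x $ i)\<^sup>2) / ?N B"
      unfolding L2_set_power2[symmetric] by (simp add: power2_eq_square)
    also have "(\<Sum>i\<in>B. (x $ i)\<^sup>2) = (\<Sum>i\<in>UNIV. of_bool (i \<in> B) * (x $ i)\<^sup>2)"
      by (intro sum.mono_neutral_cong_left) auto
    finally have "of_bool (k \<in> B) / ?N B - ?N B
      = (\<Sum>i\<in>UNIV. of_bool (k \<in> B) * (x $ i)\<^sup>2 - of_bool (i \<in> B) * (x $ i)\<^sup>2) / ?N B"
      by (simp only: sum_subtractf sum_distrib_left[symmetric] unit diff_divide_distrib mult_1_right)
    also have "\<dots> = (\<Sum>i\<in>UNIV. (x $ i)\<^sup>2 * ((of_bool (k \<in> B) - of_bool (i \<in> B)) * (1 / ?N B)))"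
      unfolding sum_divide_distrib by (intro sum.cong) (auto simp: of_bool_def)
    finally show ?thesis .
  qed
  have "(\<Sum>B\<in>UNIV. ?w B * (of_bool (k \<in> B) * x $ k / ?N B)) - x $ k * mean_masked_norm \<eta> x
    = x $ k * (\<Sum>B\<in>UNIV. ?w B * (of_bool (k \<in> B) / ?N B - ?N B))"
    unfolding mean_masked_norm_def
    by (simp add: sum_distrib_left sum_subtractf[symmetric] algebra_simps)
  also have "(\<Sum>B\<in>UNIV. ?w B * (of_bool (k \<in> B) / ?N B - ?N B))
    = (\<Sum>B\<in>UNIV. \<Sum>i\<in>UNIV. (x $ i)\<^sup>2 * (?w B * ((of_bool (k \<in> B) - of_bool (i \<in> B)) * (1 / ?N B))))"
    unfolding * by (simp add: sum_distrib_left mult.left_commute)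
  also have "\<dots> = (\<Sum>i\<in>UNIV. (x $ i)\<^sup>2 *
       (\<Sum>B\<in>UNIV. ?w B * ((of_bool (k \<in> B) - of_bool (i \<in> B)) * (1 / ?N B))))"
    by (subst sum.swap) (simp add: sum_distrib_left)
  finally show ?thesis .
qed

lemma mean_masked_norm_radial_excess_le:
  fixes x :: "real ^ 'n"
  assumes \<eta>: "0 \<le> \<eta>" "\<eta> \<le> 1" and \<xi>: "\<xi> > 1" and x: "norm x = 1" "x $ k > 0"
    and dom: "\<And>i. i \<noteq> k \<Longrightarrow> \<xi> * \<bar>x $ i\<bar> \<le> x $ k"
  shows "(\<Sum>B\<in>UNIV. mask_weight \<eta> UNIV B * (of_bool (k \<in> B) * x $ k / L2_set (($) x) B))
      - x $ k * mean_masked_norm \<eta> x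
    \<le> - (\<eta> * (1 - \<eta>) * (1 - 1 / \<xi>\<^sup>2) * (x $ k) ^ 3 * sqrt (1 - (x $ k)\<^sup>2) / 2)"
proof -
  let ?w = "mask_weight \<eta> UNIV :: 'n set \<Rightarrow> real" and ?N = "L2_set (($) x)"
  define s where "s = sqrt (1 - (x $ k)\<^sup>2)"
  define c where "c = \<eta> * (1 - \<eta>) * ((1 - 1 / \<xi>\<^sup>2) * (x $ k)\<^sup>2 / (2 * s))"
  define T where "T i = (\<Sum>B\<in>UNIV. ?w B * ((of_bool (k \<in> B) - of_bool (i \<in> B)) * (1 / ?N B)))" for i
  have unit: "(\<Sum>i\<in>UNIV. (x $ i)\<^sup>2) = 1"
    using x by (simp add: norm_vec_def L2_set_def)
  then have rest: "(\<Sum>i\<in>- {k}. (x $ i)\<^sup>2) = 1 - (x $ k)\<^sup>2"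
    by (subst (asm) sum.remove[of _ k]) (auto simp: Compl_eq_Diff_UNIV)
  have s2: "s\<^sup>2 = 1 - (x $ k)\<^sup>2"
    unfolding s_def rest[symmetric] by (simp add: sum_nonneg)
  have s0: "0 \<le> s"
    unfolding s_def rest[symmetric] by (simp add: sum_nonneg)
  \<comment> \<open>If \<open>x $ i = 0\<close>, a masked norm in \<open>T i\<close> can vanish, but the factor \<open>(x $ i)\<^sup>2\<close> removes the term.\<close>
  have T: "(x $ i)\<^sup>2 * T i \<le> (x $ i)\<^sup>2 * - c" if "i \<noteq> k" for i
  proof (cases "x $ i = 0")
    case False
    have "(1 - 1 / \<xi>\<^sup>2) * (x $ k)\<^sup>2 / (2 * s) \<le> 1 / ?N (insert i C) - 1 / ?N (insert k C)"
      if C: "C \<subseteq> - {k, i}" for C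
    proof -
      define R where "R = (?N C)\<^sup>2"
      have C': "k \<notin> C" "i \<notin> C" using C by auto
      have N: "?N (insert i C) = sqrt ((x $ i)\<^sup>2 + R)" "?N (insert k C) = sqrt ((x $ k)\<^sup>2 + R)"
        using C' by (simp_all add: R_def)
      have "(\<xi> * \<bar>x $ i\<bar>)\<^sup>2 \<le> (x $ k)\<^sup>2"
        using dom[OF \<open>i \<noteq> k\<close>] \<xi> by (intro power_mono) auto
      then have sq: "(x $ i)\<^sup>2 \<le> (x $ k)\<^sup>2 / \<xi>\<^sup>2"
        using \<xi> by (simp add: field_simps power_mult_distrib)
      have "(x $ k)\<^sup>2 / \<xi>\<^sup>2 \<le> (x $ k)\<^sup>2 / 1"
        using \<xi> by (intro divide_left_mono) auto
      with sq have le: "(x $ i)\<^sup>2 \<le> (x $ k)\<^sup>2" by simp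
      have "(\<Sum>j\<in>insert k C. (x $ j)\<^sup>2) \<le> (\<Sum>j\<in>UNIV. (x $ j)\<^sup>2)"
        "(\<Sum>j\<in>insert i C. (x $ j)\<^sup>2) \<le> (\<Sum>j\<in>- {k}. (x $ j)\<^sup>2)"
        using C \<open>i \<noteq> k\<close> by (auto intro!: sum_mono2)
      then have b: "(x $ k)\<^sup>2 + R \<le> 1" and a: "(x $ i)\<^sup>2 + R \<le> s\<^sup>2"
        using C' unfolding R_def L2_set_power2 unit rest s2 by simp_all
      have "sqrt ((x $ i)\<^sup>2 + R) \<le> s"
        using a s0 real_le_lsqrt by blast
      moreover have "0 < (x $ i)\<^sup>2 + R"
        using False by (simp add: R_def add_pos_nonneg)
      ultimately have "((x $ k)\<^sup>2 + R - ((x $ i)\<^sup>2 + R)) / (2 * s)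
          \<le> 1 / ?N (insert i C) - 1 / ?N (insert k C)"
        unfolding N using le b by (intro inverse_sqrt_diff_ge) auto
      moreover have "(1 - 1 / \<xi>\<^sup>2) * (x $ k)\<^sup>2 / (2 * s) \<le> ((x $ k)\<^sup>2 + R - ((x $ i)\<^sup>2 + R)) / (2 * s)"
      proof (intro divide_right_mono)
        show "0 \<le> 2 * s" using s0 by simp
      qed (use sq in \<open>simp add: algebra_simps\<close>)
      ultimately show ?thesis by linarith
    qed
    then have "(\<Sum>C\<in>Pow (- {k, i}). mask_weight \<eta> (- {k, i}) C * (1 / ?N (insert k C) - 1 / ?N (insert i C)))
      \<le> (\<Sum>C\<in>Pow (- {k, i}). mask_weight \<eta> (- {k, i}) C * - ((1 - 1 / \<xi>\<^sup>2) * (x $ k)\<^sup>2 / (2 * s)))"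
      using \<eta> by (intro sum_mono mult_left_mono mask_weight_nonneg) (auto simp: algebra_simps)
    also have "\<dots> = - ((1 - 1 / \<xi>\<^sup>2) * (x $ k)\<^sup>2 / (2 * s))"
      by (simp only: sum_distrib_right[symmetric]) (simp add: sum_mask_weight)
    finally have "T i \<le> \<eta> * (1 - \<eta>) * - ((1 - 1 / \<xi>\<^sup>2) * (x $ k)\<^sup>2 / (2 * s))"
      unfolding T_def sum_mask_weight_swap[OF \<open>i \<noteq> k\<close>[symmetric]]
      using \<eta> by (intro mult_left_mono) auto
    then show ?thesis by (intro mult_left_mono) (auto simp: c_def)
  qed simp
  have "(\<Sum>i\<in>UNIV. (x $ i)\<^sup>2 * T i) = (\<Sum>i\<in>- {k}. (x $ i)\<^sup>2 * T i)"
    by (subst sum.remove[of _ k]) (auto simp: Compl_eq_Diff_UNIV T_def)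
  also have "\<dots> \<le> (\<Sum>i\<in>- {k}. (x $ i)\<^sup>2 * - c)"
    using T by (intro sum_mono) auto
  also have "\<dots> = - (c * s\<^sup>2)"
    by (simp only: sum_distrib_right[symmetric] rest s2) simp
  \<comment> \<open>True also for \<open>s = 0\<close>, where both sides vanish.\<close>
  also have "\<dots> = - (\<eta> * (1 - \<eta>) * ((1 - 1 / \<xi>\<^sup>2) * (x $ k)\<^sup>2 / 2) * s)"
    by (simp add: c_def power2_eq_square)
  finally have "x $ k * (\<Sum>i\<in>UNIV. (x $ i)\<^sup>2 * T i)
    \<le> x $ k * - (\<eta> * (1 - \<eta>) * ((1 - 1 / \<xi>\<^sup>2) * (x $ k)\<^sup>2 / 2) * s)"
    using x by (intro mult_left_mono) auto
  also have "\<dots> = - (\<eta> * (1 - \<eta>) * (1 - 1 / \<xi>\<^sup>2) * (x $ k) ^ 3 * s / 2)"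
    by (simp add: power2_eq_square power3_eq_cube)
  finally show ?thesis
    unfolding mean_masked_norm_radial_excess[OF x(1)] T_def s_def .
qed

section \<open>Clarke subgradients of homogeneous Lipschitz functions\<close>

lemma has_real_derivative_line:
  fixes f :: "'a::euclidean_space \<Rightarrow> real"
  assumes "GDERIV f y :> g"
  shows "((\<lambda>t. f (y + t *\<^sub>R w)) has_real_derivative w \<bullet> g) (at 0)"
proof -
  have "(f has_derivative (\<lambda>h. h \<bullet> g)) (at (y + 0 *\<^sub>R w))"
    using assms by (simp add: gderiv_def)
  moreover have "((\<lambda>t. y + t *\<^sub>R w) has_derivative (\<lambda>t. t *\<^sub>R w)) (at 0)"
    by (auto intro!: derivative_eq_intros)
  ultimately have "((\<lambda>t. f (y + t *\<^sub>R w)) has_derivative (\<lambda>t. (t *\<^sub>R w) \<bullet> g)) (at 0)"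
    by (rule has_derivative_compose[rotated])
  then show ?thesis
    by (simp add: has_field_derivative_def mult.commute[of _ "w \<bullet> g"])
qed

lemma norm_gradient_le_lipschitz:
  fixes f :: "'a::euclidean_space \<Rightarrow> real"
  assumes lip: "L-lipschitz_on UNIV f" and g: "GDERIV f y :> g"
  shows "norm g \<le> L"
proof (cases "g = 0")
  case False
  have "((\<lambda>t. (f (y + t *\<^sub>R g) - f y) / t) \<longlongrightarrow> g \<bullet> g) (at 0)"
    using has_real_derivative_line[OF g, of g] by (simp add: DERIV_def)
  moreover have "\<forall>\<^sub>F t in at 0. (f (y + t *\<^sub>R g) - f y) / t \<le> L * norm g"
  proof (rule eventually_at_filter[THEN iffD2], intro always_eventually allI impI)
    fix t :: real assume "t \<noteq> 0"
    have "\<bar>f (y + t *\<^sub>R g) - f y\<bar> \<le> L * (\<bar>t\<bar> * norm g)"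
      using lipschitz_onD[OF lip, of "y + t *\<^sub>R g" y] by (simp add: dist_norm)
    then have "\<bar>(f (y + t *\<^sub>R g) - f y) / t\<bar> \<le> L * norm g"
      using \<open>t \<noteq> 0\<close> by (simp add: field_simps)
    then show "(f (y + t *\<^sub>R g) - f y) / t \<le> L * norm g" by linarith
  qed
  ultimately have "g \<bullet> g \<le> L * norm g"
    by (intro tendsto_upperbound) auto
  then have "norm g * norm g \<le> L * norm g"
    by (simp add: dot_square_norm power2_eq_square)
  then show ?thesis using False by simp
qed (use lipschitz_on_nonneg[OF lip] in simp)

text \<open>Let the derivative of \<open>f\<close> in direction \<open>e\<close> exist near \<open>x\<close> and be continuous at \<open>x\<close>. The norm
  bound, Euler's identity and the value of this derivative hold for gradients near \<open>x\<close>, pass to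
  limits, and then each describe a convex set of vectors. So they hold on all of the Clarke
  subdifferential, even if \<open>f\<close> is not differentiable at \<open>x\<close>.\<close>

lemma clarke_subdifferential_homogeneous:
  fixes f :: "'a::euclidean_space \<Rightarrow> real"
  assumes lip: "L-lipschitz_on UNIV f"
    and hom: "\<And>t y. f (t *\<^sub>R y) = \<bar>t\<bar> * f y"
    and P: "isCont P x"
    and part: "\<forall>\<^sub>F y in nhds x. ((\<lambda>t. f (y + t *\<^sub>R e)) has_real_derivative P y) (at 0)"
    and v: "v \<in> clarke_subdifferential f x"
  shows "norm v \<le> L" "x \<bullet> v = f x" "e \<bullet> v = P x"
proof -
  let ?T = "cball 0 L \<inter> {v. x \<bullet> v = f x} \<inter> {v. e \<bullet> v = P x}"
  have "clarke_subdifferential f x \<subseteq> ?T"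
    unfolding clarke_subdifferential_def
  proof (rule hull_minimal)
    show "convex ?T" by (intro convex_Int convex_cball convex_hyperplane)
    show "{v. \<exists>y g. y \<longlonglongrightarrow> x \<and> (\<forall>k::nat. GDERIV f (y k) :> g k) \<and> g \<longlonglongrightarrow> v} \<subseteq> ?T"
    proof safe
      fix v y g
      assume y: "y \<longlonglongrightarrow> x" and g: "\<forall>k::nat. GDERIV f (y k) :> g k" and gv: "g \<longlonglongrightarrow> v"
      have "(\<lambda>k. norm (g k)) \<longlonglongrightarrow> norm v" using gv by (rule tendsto_norm)
      then have "norm v \<le> L"
        by (rule tendsto_upperbound)
           (use norm_gradient_le_lipschitz[OF lip] g in \<open>auto intro!: always_eventually\<close>)
      then show "v \<in> cball 0 L" by simp
      \<comment> \<open>Along its own direction, \<open>f\<close> is linear near \<open>y k\<close>.\<close>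
      have euler: "y k \<bullet> g k = f (y k)" for k
      proof (rule DERIV_unique)
        show "((\<lambda>t. f (y k + t *\<^sub>R y k)) has_real_derivative y k \<bullet> g k) (at 0)"
          using g has_real_derivative_line by blast
        have "((\<lambda>t. (1 + t) * f (y k)) has_real_derivative f (y k)) (at 0)"
          by (auto intro!: derivative_eq_intros)
        moreover have "\<forall>\<^sub>F t in nhds 0. f (y k + t *\<^sub>R y k) = (1 + t) * f (y k)"
        proof -
          have "\<forall>\<^sub>F t in nhds (0::real). -1 < t"
            by (rule order_tendstoD(1)[OF filterlim_ident]) simp
          then show ?thesis
          proof eventually_elim
            case (elim t)
            have "f (y k + t *\<^sub>R y k) = f ((1 + t) *\<^sub>R y k)" by (simp add: algebra_simps)
            then show ?case using elim by (simp add: hom)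
          qed
        qed
        ultimately show "((\<lambda>t. f (y k + t *\<^sub>R y k)) has_real_derivative f (y k)) (at 0)"
          by (subst DERIV_cong_ev[OF refl _ refl])
      qed
      have "isCont f x"
        using lipschitz_on_continuous_on[OF lip] by (simp add: continuous_on_eq_continuous_at)
      from isCont_tendsto_compose[OF this y] have "(\<lambda>k. y k \<bullet> g k) \<longlonglongrightarrow> f x"
        by (simp only: euler)
      with tendsto_inner[OF y gv] show "x \<bullet> v = f x" by (rule LIMSEQ_unique)
      have ev: "\<forall>\<^sub>F k in sequentially. e \<bullet> g k = P (y k)"
        using eventually_compose_filterlim[OF part y]
      proof (rule eventually_mono)
        fix k assume "((\<lambda>t. f (y k + t *\<^sub>R e)) has_real_derivative P (y k)) (at 0)"
        with has_real_derivative_line[OF g[rule_format, of k], of e] show "e \<bullet> g k = P (y k)"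
          by (rule DERIV_unique)
      qed
      from isCont_tendsto_compose[OF P y] have "(\<lambda>k. e \<bullet> g k) \<longlonglongrightarrow> P x"
        by (simp add: tendsto_cong[OF ev])
      with tendsto_inner[OF tendsto_const gv, of e] show "e \<bullet> v = P x" by (rule LIMSEQ_unique)
    qed
  qed
  with v show "norm v \<le> L" "x \<bullet> v = f x" "e \<bullet> v = P x" by auto
qed

section \<open>Regularity of the mean masked norm\<close>

lemma L2_set_le_norm: "L2_set (($) x) B \<le> norm (x :: real ^ 'n)"
  unfolding norm_vec_def L2_set_def by (auto intro!: real_sqrt_le_mono sum_mono2)

lemma lipschitz_mean_masked_norm:
  fixes \<eta> :: real
  assumes "0 \<le> \<eta>" "\<eta> \<le> 1"
  shows "1-lipschitz_on UNIV (mean_masked_norm \<eta> :: real ^ 'n \<Rightarrow> real)"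
proof (rule lipschitz_onI)
  fix x y :: "real ^ 'n"
  have *: "L2_set (($) x) B - L2_set (($) y) B \<le> norm (x - y)" for x y :: "real ^ 'n" and B
  proof -
    have "L2_set (($) x) B = L2_set (\<lambda>i. y $ i + (x - y) $ i) B" by simp
    also have "\<dots> \<le> L2_set (($) y) B + L2_set (($) (x - y)) B" by (rule L2_set_triangle_ineq)
    finally show ?thesis using L2_set_le_norm[of "x - y" B] by linarith
  qed
  have "\<bar>L2_set (($) x) B - L2_set (($) y) B\<bar> \<le> norm (x - y)" for B
    using *[of x B y] *[of y B x] by (simp add: norm_minus_commute abs_le_iff)
  then have "(\<Sum>B\<in>UNIV. \<bar>mask_weight \<eta> UNIV B * (L2_set (($) x) B - L2_set (($) y) B)\<bar>)
    \<le> (\<Sum>B\<in>(UNIV :: 'n set set). mask_weight \<eta> UNIV B * norm (x - y))"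
    unfolding abs_mult using assms
    by (intro sum_mono mult_mono) (auto simp: mask_weight_nonneg)
  also have "\<dots> = norm (x - y)"
    using sum_mask_weight[of "UNIV :: 'n set" \<eta>] by (simp flip: sum_distrib_right)
  finally have "\<bar>\<Sum>B\<in>UNIV. mask_weight \<eta> UNIV B * (L2_set (($) x) B - L2_set (($) y) B)\<bar> \<le> norm (x - y)"
    by (rule order_trans[OF sum_abs])
  then show "dist (mean_masked_norm \<eta> x) (mean_masked_norm \<eta> y) \<le> 1 * dist x y"
    by (simp add: dist_norm mean_masked_norm_def right_diff_distrib sum_subtractf)
qed simp

lemma mean_masked_norm_scaleR: "mean_masked_norm \<eta> (t *\<^sub>R x) = \<bar>t\<bar> * mean_masked_norm \<eta> x"
proof -
  have "L2_set (($) (t *\<^sub>R x)) B = \<bar>t\<bar> * L2_set (($) x) B" for B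
    by (simp add: L2_set_def power_mult_distrib real_sqrt_mult flip: sum_distrib_left)
  then show ?thesis by (simp add: mean_masked_norm_def sum_distrib_left mult.left_commute)
qed

text \<open>If \<open>y\<^sub>k \<noteq> 0\<close>, then each masked norm is either constant in the \<open>k\<close>-th coordinate or positive
  at \<open>y\<close>, so the \<open>k\<close>-th partial derivative exists whether or not other coordinates vanish.\<close>

lemma has_real_derivative_mean_masked_norm:
  fixes y :: "real ^ 'n"
  assumes "y $ k \<noteq> 0"
  shows "((\<lambda>t. mean_masked_norm \<eta> (y + t *\<^sub>R axis k 1)) has_real_derivative
    (\<Sum>B\<in>UNIV. mask_weight \<eta> UNIV B * (of_bool (k \<in> B) * y $ k / L2_set (($) y) B))) (at 0)"
  unfolding mean_masked_norm_def
proof (intro DERIV_sum DERIV_cmult)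
  fix B :: "'n set"
  show "((\<lambda>t. L2_set (($) (y + t *\<^sub>R axis k 1)) B) has_real_derivative
     of_bool (k \<in> B) * y $ k / L2_set (($) y) B) (at 0)"
  proof (cases "k \<in> B")
    case False
    then have "L2_set (($) (y + t *\<^sub>R axis k 1)) B = L2_set (($) y) B" for t
      by (intro L2_set_cong) (auto simp: axis_def)
    with False show ?thesis by simp
  next
    case True
    define R where "R = (\<Sum>i\<in>B - {k}. (y $ i)\<^sup>2)"
    have "0 \<le> R" by (simp add: R_def sum_nonneg)
    have "(\<Sum>i\<in>B. ((y + t *\<^sub>R axis k 1) $ i)\<^sup>2) = (y $ k + t)\<^sup>2 + R" for t
      unfolding R_def using True by (subst sum.remove[of _ k]) (auto simp: axis_def intro!: sum.cong)
    then have N: "L2_set (($) (y + t *\<^sub>R axis k 1)) B = sqrt ((y $ k + t)\<^sup>2 + R)" for t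
      by (simp add: L2_set_def)
    from N[of 0] have N0: "L2_set (($) y) B = sqrt ((y $ k)\<^sup>2 + R)" by simp
    have pos: "0 < (y $ k)\<^sup>2 + R" using assms \<open>0 \<le> R\<close> by (simp add: add_pos_nonneg)
    show ?thesis
      unfolding N N0 using True pos
      by (auto intro!: derivative_eq_intros simp: field_simps)
  qed
qed

lemma isCont_partial_mean_masked_norm:
  fixes x :: "real ^ 'n"
  assumes "x $ k \<noteq> 0"
  shows "isCont (\<lambda>y. \<Sum>B\<in>UNIV. mask_weight \<eta> UNIV B * (of_bool (k \<in> B) * y $ k / L2_set (($) y) B)) x"
proof (intro continuous_sum continuous_mult continuous_const)
  fix B :: "'n set"
  show "isCont (\<lambda>y::real ^ 'n. of_bool (k \<in> B) * y $ k / L2_set (($) y) B) x"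
  proof (cases "k \<in> B")
    case True
    then have "L2_set (($) x) B \<noteq> 0" using assms by (auto simp: L2_set_eq_0_iff)
    then show ?thesis
      unfolding L2_set_def by (intro continuous_intros) auto
  qed simp
qed


section \<open>The objective as a mean masked norm\<close>

lemma (in prob_space) abs_normal_combination:
  fixes p :: "'a \<Rightarrow> real ^ 'n" and x :: "real ^ 'n"
  assumes "std_normal_vector M p"
  shows "integrable M (\<lambda>\<omega>. \<bar>\<Sum>i\<in>B. x $ i * p \<omega> $ i\<bar>)"
    and "expectation (\<lambda>\<omega>. \<bar>\<Sum>i\<in>B. x $ i * p \<omega> $ i\<bar>) = sqrt (2 / pi) * L2_set (($) x) B"
proof -
  have ind: "indep_vars (\<lambda>_. borel) (\<lambda>i \<omega>. p \<omega> $ i) UNIV"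
    and dist: "\<And>i. distributed M lborel (\<lambda>\<omega>. p \<omega> $ i) std_normal_density"
    using assms by (auto simp: std_normal_vector_def)
  \<comment> \<open>Terms with zero coefficient are dropped, since a normal density needs a positive deviation.\<close>
  define J where "J = {i \<in> B. x $ i \<noteq> 0}"
  have sumJ: "(\<Sum>i\<in>B. x $ i * p \<omega> $ i) = (\<Sum>i\<in>J. x $ i * p \<omega> $ i)" for \<omega>
    unfolding J_def by (intro sum.mono_neutral_right) auto
  have L2J: "L2_set (($) x) B = sqrt (\<Sum>i\<in>J. \<bar>x $ i\<bar>\<^sup>2)"
    unfolding L2_set_def J_def by (intro arg_cong[where f = sqrt] sum.mono_neutral_cong_right) auto
  have "integrable M (\<lambda>\<omega>. \<bar>\<Sum>i\<in>J. x $ i * p \<omega> $ i\<bar>) \<and>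
    expectation (\<lambda>\<omega>. \<bar>\<Sum>i\<in>J. x $ i * p \<omega> $ i\<bar>) = sqrt (2 / pi) * sqrt (\<Sum>i\<in>J. \<bar>x $ i\<bar>\<^sup>2)"
  proof (cases "J = {}")
    case False
    define \<sigma> where "\<sigma> = sqrt (\<Sum>i\<in>J. \<bar>x $ i\<bar>\<^sup>2)"
    have "distributed M lborel (\<lambda>\<omega>. \<Sum>i\<in>J. x $ i * p \<omega> $ i)
        (normal_density (\<Sum>i\<in>J. 0) (sqrt (\<Sum>i\<in>J. \<bar>x $ i\<bar>\<^sup>2)))"
    proof (rule sum_indep_normal)
      show "indep_vars (\<lambda>_. borel) (\<lambda>i \<omega>. x $ i * p \<omega> $ i) J"
        by (rule indep_vars_compose2[OF indep_vars_subset[OF ind]]) auto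
      show "distributed M lborel (\<lambda>\<omega>. x $ i * p \<omega> $ i) (normal_density 0 \<bar>x $ i\<bar>)" if "i \<in> J" for i
        using normal_density_affine[OF dist[of i], of "x $ i" 0] that by (simp add: J_def)
    qed (use False in \<open>auto simp: J_def\<close>)
    then have D: "distributed M lborel (\<lambda>\<omega>. \<Sum>i\<in>J. x $ i * p \<omega> $ i) (normal_density 0 \<sigma>)"
      by (simp add: \<sigma>_def)
    have "0 < (\<Sum>i\<in>J. \<bar>x $ i\<bar>\<^sup>2)"
      using False by (intro sum_pos) (auto simp: J_def)
    then have "0 < \<sigma>" by (simp add: \<sigma>_def)
    from normal_moment_abs_odd[OF this, of 0 0]
    have "has_bochner_integral lborel (\<lambda>x. normal_density 0 \<sigma> x * \<bar>x\<bar>) (\<sigma> * sqrt (2 / pi))"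
      by simp
    then show ?thesis
      unfolding \<sigma>_def[symmetric]
      using distributed_integrable[OF D, of "\<lambda>x. \<bar>x\<bar>"] distributed_integral[OF D, of "\<lambda>x. \<bar>x\<bar>"]
      by (simp add: has_bochner_integral_iff mult.commute)
  qed simp
  then show "integrable M (\<lambda>\<omega>. \<bar>\<Sum>i\<in>B. x $ i * p \<omega> $ i\<bar>)"
    and "expectation (\<lambda>\<omega>. \<bar>\<Sum>i\<in>B. x $ i * p \<omega> $ i\<bar>) = sqrt (2 / pi) * L2_set (($) x) B"
    unfolding sumJ L2J by simp_all
qed

lemma (in prob_space) bernoulli_vector_support:
  fixes b :: "'a \<Rightarrow> real ^ 'n"
  assumes \<eta>: "0 \<le> \<eta>" "\<eta> \<le> 1" and b: "bernoulli_vector \<eta> M b"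
  shows "prob {\<omega> \<in> space M. {i. b \<omega> $ i \<noteq> 0} = B} = mask_weight \<eta> UNIV B"
    and "AE \<omega> in M. \<forall>i. b \<omega> $ i \<in> {0, 1}"
proof -
  have ind: "indep_vars (\<lambda>_. borel) (\<lambda>i \<omega>. b \<omega> $ i) UNIV"
    and dist: "\<And>i. distr M borel (\<lambda>\<omega>. b \<omega> $ i) = distr (measure_pmf (bernoulli_pmf \<eta>)) borel of_bool"
    using b by (auto simp: bernoulli_vector_def)
  have meas[measurable]: "(\<lambda>\<omega>. b \<omega> $ i) \<in> borel_measurable M" for i
    using ind by (auto simp: indep_vars_def)
  have prob_eq: "prob ((\<lambda>\<omega>. b \<omega> $ i) -` A \<inter> space M)
      = measure (measure_pmf (bernoulli_pmf \<eta>)) (of_bool -` A)" if "A \<in> sets borel" for i and A :: "real set"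
  proof -
    have "prob ((\<lambda>\<omega>. b \<omega> $ i) -` A \<inter> space M) = measure (distr M borel (\<lambda>\<omega>. b \<omega> $ i)) A"
      using that by (simp add: measure_distr)
    also have "\<dots> = measure (measure_pmf (bernoulli_pmf \<eta>)) (of_bool -` A)"
      unfolding dist using that by (simp add: measure_distr)
    finally show ?thesis .
  qed
  have t: "of_bool -` (- {0::real}) = {True}" and f: "of_bool -` {0::real} = {False}"
    by auto
  \<comment> \<open>The event that the support is \<open>B\<close> is an intersection of coordinatewise events.\<close>
  define A :: "'n \<Rightarrow> real set" where "A i = (if i \<in> B then - {0} else {0})" for i
  have "{\<omega> \<in> space M. {i. b \<omega> $ i \<noteq> 0} = B} = (\<Inter>i\<in>UNIV. (\<lambda>\<omega>. b \<omega> $ i) -` A i \<inter> space M)"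
    by (auto simp: A_def split: if_splits)
  also have "prob \<dots> = (\<Prod>i\<in>UNIV. prob ((\<lambda>\<omega>. b \<omega> $ i) -` A i \<inter> space M))"
    by (rule indep_varsD_finite[OF ind]) (auto simp: A_def)
  also have "\<dots> = mask_weight \<eta> UNIV B"
    unfolding mask_weight_def
    by (intro prod.cong) (use \<eta> in \<open>auto simp: A_def prob_eq t f measure_pmf_single\<close>)
  finally show "prob {\<omega> \<in> space M. {i. b \<omega> $ i \<noteq> 0} = B} = mask_weight \<eta> UNIV B" .
  have "AE \<omega> in M. b \<omega> $ i \<in> {0, 1}" for i
  proof -
    have "of_bool -` {0::real, 1} = UNIV" by auto
    then have "prob ((\<lambda>\<omega>. b \<omega> $ i) -` {0, 1} \<inter> space M) = 1"
      by (simp add: prob_eq)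
    then have "AE \<omega> in M. \<omega> \<in> (\<lambda>\<omega>. b \<omega> $ i) -` {0, 1} \<inter> space M"
      by (subst (asm) prob_eq_1) auto
    then show ?thesis by eventually_elim auto
  qed
  then show "AE \<omega> in M. \<forall>i. b \<omega> $ i \<in> {0, 1}"
    by (simp add: AE_all_countable)
qed

lemma (in prob_space) f_dic_eq_mean_masked_norm:
  fixes p b z :: "'a \<Rightarrow> real ^ 'n" and x :: "real ^ 'n"
  assumes \<eta>: "0 \<le> \<eta>" "\<eta> \<le> 1"
    and p: "std_normal_vector M p" and b: "bernoulli_vector \<eta> M b"
    and indep: "indep_var borel p borel b"
    and z: "\<And>\<omega>. z \<omega> = (\<chi> i. p \<omega> $ i * b \<omega> $ i)"
  shows "f_dic M z x = sqrt (2 / pi) * mean_masked_norm \<eta> x"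
proof -
  define supp :: "real ^ 'n \<Rightarrow> 'n set" where "supp v = {i. v $ i \<noteq> 0}" for v
  have p_meas[measurable]: "p \<in> borel_measurable M" and b_meas[measurable]: "b \<in> borel_measurable M"
    using indep by (auto dest: indep_var_rv1 indep_var_rv2)
  have nth_meas[measurable]: "(\<lambda>v::real ^ 'n. v $ i) \<in> borel_measurable borel" for i
    by (intro borel_measurable_continuous_onI continuous_intros)
  have supp_meas[measurable]: "Measurable.pred borel (\<lambda>v. supp v = B)" for B
  proof -
    have "(\<lambda>v. supp v = B) = (\<lambda>v. \<forall>i. (v $ i \<noteq> 0) = (i \<in> B))"
      by (auto simp: supp_def fun_eq_iff)
    moreover have "Measurable.pred borel (\<lambda>v::real ^ 'n. \<forall>i. (v $ i \<noteq> 0) = (i \<in> B))"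
      by measurable
    ultimately show ?thesis by simp
  qed
  let ?S = "\<lambda>B \<omega>. \<bar>\<Sum>i\<in>B. x $ i * p \<omega> $ i\<bar>"
  let ?I = "\<lambda>B \<omega>. of_bool (supp (b \<omega>) = B) :: real"
  have I: "integrable M (?I B)" "expectation (?I B) = mask_weight \<eta> UNIV B" for B
  proof -
    have ind: "?I B \<omega> = indicator {\<omega> \<in> space M. supp (b \<omega>) = B} \<omega>" if "\<omega> \<in> space M" for \<omega>
      using that by (simp add: indicator_def)
    have [measurable]: "{\<omega> \<in> space M. supp (b \<omega>) = B} \<in> events"
      by measurable
    show "integrable M (?I B)"
      by (subst Bochner_Integration.integrable_cong[OF refl ind])
         (auto intro!: integrable_real_indicator simp: less_top[symmetric])
    have "expectation (?I B) = prob {\<omega> \<in> space M. supp (b \<omega>) = B}"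
      by (subst Bochner_Integration.integral_cong[OF refl ind]) auto
    then show "expectation (?I B) = mask_weight \<eta> UNIV B"
      unfolding supp_def bernoulli_vector_support(1)[OF \<eta> b] .
  qed
  have SI: "indep_var borel (?S B) borel (?I B)" for B
  proof -
    have "(\<lambda>v::real ^ 'n. \<bar>\<Sum>i\<in>B. x $ i * v $ i\<bar>) \<in> borel_measurable borel"
      by (intro borel_measurable_continuous_onI continuous_intros)
    moreover have "(\<lambda>v. of_bool (supp v = B) :: real) \<in> borel_measurable borel"
      by measurable
    ultimately show ?thesis
      using indep_var_compose[OF indep, of "\<lambda>v. \<bar>\<Sum>i\<in>B. x $ i * v $ i\<bar>" borel "\<lambda>v. of_bool (supp v = B) :: real" borel]
      by (simp add: comp_def)
  qed
  note S = abs_normal_combination[OF p, where x = x]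
  have prod: "integrable M (\<lambda>\<omega>. ?S B \<omega> * ?I B \<omega>)"
    "expectation (\<lambda>\<omega>. ?S B \<omega> * ?I B \<omega>) = sqrt (2 / pi) * L2_set (($) x) B * mask_weight \<eta> UNIV B" for B
    using indep_var_integrable[OF SI S(1) I(1)] indep_var_lebesgue_integral[OF SI S(1) I(1)]
    by (simp_all add: S(2) I(2))
  \<comment> \<open>Exactly one indicator is \<open>1\<close>, the one of the support of \<open>b\<close>.\<close>
  have "AE \<omega> in M. \<bar>x \<bullet> z \<omega>\<bar> = (\<Sum>B\<in>UNIV. ?S B \<omega> * ?I B \<omega>)"
    using bernoulli_vector_support(2)[OF \<eta> b]
  proof eventually_elim
    case (elim \<omega>)
    have "(\<Sum>B\<in>UNIV. ?S B \<omega> * ?I B \<omega>) = ?S (supp (b \<omega>)) \<omega>"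
      by (simp add: of_bool_def if_distrib cong: if_cong)
    also have "(\<Sum>i\<in>supp (b \<omega>). x $ i * p \<omega> $ i) = x \<bullet> z \<omega>"
      unfolding inner_vec_def z using elim
      by (intro sum.mono_neutral_cong_left) (auto simp: supp_def)
    finally show ?case by simp
  qed
  moreover have "(\<lambda>\<omega>. \<bar>x \<bullet> z \<omega>\<bar>) \<in> borel_measurable M"
    unfolding inner_vec_def z by simp
  ultimately have "f_dic M z x = expectation (\<lambda>\<omega>. \<Sum>B\<in>UNIV. ?S B \<omega> * ?I B \<omega>)"
    unfolding f_dic_def
    by (intro integral_cong_AE borel_measurable_sum borel_measurable_integrable[OF prod(1)])
  also have "\<dots> = (\<Sum>B\<in>UNIV. sqrt (2 / pi) * L2_set (($) x) B * mask_weight \<eta> UNIV B)"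
    by (subst Bochner_Integration.integral_sum) (simp_all only: prod)
  also have "\<dots> = sqrt (2 / pi) * mean_masked_norm \<eta> x"
    by (simp add: mean_masked_norm_def sum_distrib_left mult_ac)
  finally show ?thesis .
qed

section \<open>Alignment of the Riemannian subgradients\<close>

theorem theorem5p16:
  fixes M :: "'s measure" and p b z :: "'s \<Rightarrow> real ^ 'n" and i1 :: 'n
    and \<eta> \<xi> \<alpha> :: real
  assumes "prob_space M"
    and "0 < \<eta>" and "\<eta> < 1" and "\<xi> > 1" and "\<alpha> > 0"
    and "std_normal_vector M p"
    and "bernoulli_vector \<eta> M b"
    and "prob_space.indep_var M borel p borel b"
    and "\<And>\<omega>. z \<omega> = (\<chi> i. p \<omega> $ i * b \<omega> $ i)"
  shows "RGA_on (\<alpha> ^ 3 * \<eta> * (1 - \<eta>) * (1 - 1 / \<xi>\<^sup>2) / sqrt (2 * pi))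
           (f_dic M z) (S_dic \<xi> i1 \<alpha>) (axis i1 1)"
proof -
  define c where "c = sqrt (2 / pi)"
  define f :: "real ^ 'n \<Rightarrow> real" where "f x = c * mean_masked_norm \<eta> x" for x
  define P where "P x = c * (\<Sum>B\<in>UNIV. mask_weight \<eta> UNIV B * (of_bool (i1 \<in> B) * x $ i1 / L2_set (($) x) B))"
    for x :: "real ^ 'n"
  define \<mu> where "\<mu> = \<alpha> ^ 3 * \<eta> * (1 - \<eta>) * (1 - 1 / \<xi>\<^sup>2) / sqrt (2 * pi)"
  let ?e = "axis i1 1 :: real ^ 'n"
  have fdic: "f_dic M z = f"
    unfolding f_def c_def
    using prob_space.f_dic_eq_mean_masked_norm[of M \<eta> p b z] assms by (intro ext) simp
  have c: "0 < c" "c \<le> 1" "c / 2 = 1 / sqrt (2 * pi)"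
  proof -
    show "0 < c" by (simp add: c_def)
    show "c \<le> 1" unfolding c_def using pi_gt3 by simp
    have "c * sqrt (2 * pi) = sqrt (2 / pi * (2 * pi))"
      unfolding c_def by (simp only: real_sqrt_mult)
    also have "2 / pi * (2 * pi) = 2\<^sup>2" by simp
    finally show "c / 2 = 1 / sqrt (2 * pi)" by (simp add: field_simps)
  qed
  have "(\<bar>c\<bar> * 1)-lipschitz_on UNIV f"
    unfolding f_def using assms(2,3)
    by (intro lipschitz_on_cmult_real lipschitz_mean_masked_norm) auto
  then have lip: "1-lipschitz_on UNIV f"
    by (rule lipschitz_on_le) (use c in simp)
  have hom: "f (t *\<^sub>R y) = \<bar>t\<bar> * f y" for t y
    by (simp add: f_def mean_masked_norm_scaleR)
  have \<xi>: "0 < 1 - 1 / \<xi>\<^sup>2" using assms(4) by simp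
  have \<mu>: "0 < \<mu>" using assms \<xi> unfolding \<mu>_def by simp
  have "RGA_at \<mu> f x ?e" if x: "x \<in> S_dic \<xi> i1 \<alpha>" for x
  proof -
    define s where "s = sqrt (1 - (x $ i1)\<^sup>2)"
    have xe: "x \<bullet> ?e = x $ i1" by (simp add: inner_axis)
    have nx: "norm x = 1" and dom: "\<And>i. i \<noteq> i1 \<Longrightarrow> \<xi> * \<bar>x $ i\<bar> \<le> x $ i1"
      using x by (auto simp: S_dic_def)
    have x1: "\<bar>x $ i1\<bar> \<le> 1" using component_le_norm_cart[of x i1] nx by simp
    have \<alpha>: "\<alpha> \<le> x $ i1" using x x1 by (simp add: S_dic_def sphere_angle_def xe)
    have x_pos: "0 < x $ i1" using \<alpha> assms(5) by simp
    have sin: "sin (sphere_angle x ?e) = s"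
      using x1 by (simp add: sphere_angle_def xe s_def sin_arccos_abs)
    have s0: "0 \<le> s" using x1 by (simp add: s_def abs_square_le_1)
    have excess: "P x - x $ i1 * f x \<le> - (\<mu> * s)"
    proof -
      have "P x - x $ i1 * f x = c * ((\<Sum>B\<in>UNIV. mask_weight \<eta> UNIV B * (of_bool (i1 \<in> B) * x $ i1 / L2_set (($) x) B))
          - x $ i1 * mean_masked_norm \<eta> x)"
        by (simp add: P_def f_def algebra_simps)
      also have "\<dots> \<le> c * - (\<eta> * (1 - \<eta>) * (1 - 1 / \<xi>\<^sup>2) * (x $ i1) ^ 3 * s / 2)"
        unfolding s_def using c assms nx x_pos dom
        by (intro mult_left_mono mean_masked_norm_radial_excess_le) auto
      also have "\<dots> = - ((c / 2) * (\<eta> * (1 - \<eta>) * (1 - 1 / \<xi>\<^sup>2)) * s * (x $ i1) ^ 3)"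
        by simp
      also have "\<dots> \<le> - ((c / 2) * (\<eta> * (1 - \<eta>) * (1 - 1 / \<xi>\<^sup>2)) * s * \<alpha> ^ 3)"
        using c assms \<xi> s0 \<alpha> by (intro le_imp_neg_le mult_left_mono power_mono mult_nonneg_nonneg) auto
      also have "\<dots> = - (\<mu> * s)" unfolding c(3) by (simp add: \<mu>_def)
      finally show ?thesis .
    qed
    show ?thesis
      unfolding RGA_at_def riemannian_clarke_subdifferential_def sin
    proof (intro ballI, elim imageE)
      fix g v assume v: "v \<in> clarke_subdifferential f x" and g: "g = v - (x \<bullet> v) *\<^sub>R x"
      have part: "\<forall>\<^sub>F y in nhds x. ((\<lambda>t. f (y + t *\<^sub>R ?e)) has_real_derivative P y) (at 0)"
      proof -
        have "\<forall>\<^sub>F y in nhds x. y $ i1 > 0"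
          using x_pos by (intro order_tendstoD(1)[where y = "x $ i1"] tendsto_vec_nth filterlim_ident)
        then show ?thesis
          unfolding f_def P_def
          by eventually_elim (intro DERIV_cmult has_real_derivative_mean_masked_norm; simp)
      qed
      have "isCont P x"
        unfolding P_def using x_pos by (intro continuous_intros isCont_partial_mean_masked_norm) auto
      note V = clarke_subdifferential_homogeneous[OF lip hom this part v]
      have ge: "g \<bullet> ?e = P x - x $ i1 * f x"
        using V by (simp add: g inner_diff_left xe inner_commute[of ?e] mult.commute)
      have "(norm g)\<^sup>2 = (norm v)\<^sup>2 - (x \<bullet> v)\<^sup>2"
        unfolding power2_norm_eq_inner using nx
        by (simp add: g inner_diff_left inner_diff_right inner_commute[of v x] power2_eq_square
            norm_eq_1)
      then have "(norm g)\<^sup>2 \<le> 1\<^sup>2" using power_mono[OF V(1) norm_ge_zero, of 2] zero_le_power2[of "x \<bullet> v"] by linarith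
      then have ng: "norm g \<le> 1" by (rule power2_le_imp_le) simp
      have "g \<bullet> ?e \<le> - (\<mu> * s)" using ge excess by simp
      also have "\<dots> \<le> - (\<mu> * s * norm g)"
        using mult_left_mono[OF ng, of "\<mu> * s"] \<mu> s0 by simp
      finally have "g \<bullet> ?e \<le> - \<mu> * s * norm g" by simp
      moreover have "g \<noteq> 0" if "x \<noteq> ?e"
      proof
        assume "g = 0"
        then have "\<mu> * s \<le> 0" using ge excess by simp
        then have "s = 0" using \<mu> s0 by (simp add: mult_le_0_iff)
        then have "(x $ i1)\<^sup>2 = 1" by (simp add: s_def)
        then have "x \<bullet> ?e = 1" using x_pos xe by (auto simp: power2_eq_1_iff)
        then have "(x - ?e) \<bullet> (x - ?e) = 0"
          using nx by (simp add: inner_diff_left inner_diff_right norm_eq_1 inner_commute[of ?e x] inner_axis_axis)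
        then have "x = ?e" by simp
        with that show False by simp
      qed
      ultimately show "(x \<noteq> ?e \<longrightarrow> g \<noteq> 0) \<and> g \<bullet> ?e \<le> - \<mu> * s * norm g" by simp
    qed
  qed
  moreover have "locally_lipschitz f"
    unfolding locally_lipschitz_def using lipschitz_on_subset[OF lip] by (meson subset_UNIV zero_less_one)
  ultimately show ?thesis
    unfolding RGA_on_def fdic \<mu>_def[symmetric] by blast
qed

end
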